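(* Let $m\ge 2$ and let $\Omega_1,\ldots,\Omega_m\subset\mathbb{R}^n$ be convex sets satisfying the relative interior condition $$\bigcap_{i=1}^m\mathrm{ri}(\Omega_i)\neq\emptyset.$$ Then $$N\Big(\bar{x};\bigcap_{i=1}^m\Omega_i\Big)=\sum_{i=1}^m N(\bar{x};\Omega_i)\quad\text{for all }\bar{x}\in\bigcap_{i=1}^m\Omega_i.$$
   Context: $\mathbb{R}^n$ carries the Euclidean inner product $\langle\cdot,\cdot\rangle$. For a convex set $\Omega\subset\mathbb{R}^n$, the relative interior $\mathrm{ri}(\Omega)$ is the set of $x\in\Omega$ for which there is $\gamma>0$ with $\mathbb{B}(x;\gamma)\cap\mathrm{aff}(\Omega)\subset\Omega$, where $\mathbb{B}(x;\gamma)$ is the closed ball and $\mathrm{aff}(\Omega)$ the affine hull. The normal cone to a nonempty convex set $\Omega$ at $\bar{x}\in\Omega$ is $N(\bar{x};\Omega):=\{v\in\mathbb{R}^n : \langle v,x-\bar{x}\rangle\le 0\text{ for all }x\in\Omega\}$. The sum of sets is the Minkowski sum. *)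

theory Defs
  imports "HOL-Analysis.Analysis" "HOL-Library.Set_Algebras"
begin

(* The formula is only meant for x0 \<in> \<Omega>; no special value is assigned outside \<Omega>.
   Sums of sets are the Minkowski sums of HOL-Library.Set_Algebras, and rel_interior agrees
   with the closed-ball description of ri by rel_interior_cball. *)
definition normal_cone :: "'a::real_inner \<Rightarrow> 'a set \<Rightarrow> 'a set" where
  "normal_cone x0 \<Omega> = {v. \<forall>x\<in>\<Omega>. v \<bullet> (x - x0) \<le> 0}"

end

theory Submission
  imports Defs
begin

text \<open>
  The inclusion of the sum in the normal cone of the intersection is immediate. For the other one,
  consider two convex sets \<open>A\<close>, \<open>B\<close> and \<open>v\<close> normal to \<open>A \<inter> B\<close> at \<open>x0\<close>. Then \<open>0\<close> lies outside
  the convex set \<open>C\<close> of all pairs \<open>(a - b, r)\<close> with \<open>a \<in> A\<close>, \<open>b \<in> B\<close> and \<open>r < v \<bullet> (a - x0)\<close>, for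
  \<open>a = b\<close> forces \<open>r < 0\<close>. A hyperplane through \<open>0\<close>, with normal \<open>(w, g)\<close> in the span of that
  set, has the set on one side. If it were vertical (\<open>g = 0\<close>), then \<open>w\<close> would be minimal on \<open>A\<close>
  and maximal on \<open>B\<close> at any common point of the two relative interiors, hence constant on both
  with the same value (\<open>inner_constant_if_min_in_rel_interior\<close>);
  the normal would be orthogonal to the set whose span contains it, thus zero.
  So \<open>g \<noteq> 0\<close>, and after normalising to \<open>g = -1\<close> the separation inequality
  \<open>v \<bullet> (a - x0) \<le> w \<bullet> (a - b)\<close> splits \<open>v\<close> as \<open>(v - w) + w\<close>: take \<open>b = x0\<close>, then \<open>a = x0\<close>.
  This is \<open>normal_cone_Int\<close>.

  A finite family reduces to two sets by induction, because the relative interior of the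
  intersection is the intersection of the relative interiors as soon as the latter is nonempty.
\<close>

lemma normal_cone_UNIV: "normal_cone x0 UNIV = {0}"
proof -
  have "v = 0" if "\<forall>x. v \<bullet> (x - x0) \<le> 0" for v :: 'a
    using that[rule_format, of "x0 + v"]
    by (metis add_diff_cancel_left' inner_gt_zero_iff linorder_not_less)
  then show ?thesis by (auto simp: normal_cone_def)
qed

text \<open>From a relative interior point, every segment into the set can be prolonged beyond that point;
  a strict increase towards \<open>a\<close> would become a strict decrease on the prolongation.\<close>
lemma inner_constant_if_min_in_rel_interior:
  fixes A :: "'a::euclidean_space set"
  assumes "convex A" "z \<in> rel_interior A" "\<And>a. a \<in> A \<Longrightarrow> w \<bullet> z \<le> w \<bullet> a" "a \<in> A"
  shows "w \<bullet> a = w \<bullet> z"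
proof -
  obtain e where e: "e > 1" "(1 - e) *\<^sub>R a + e *\<^sub>R z \<in> A"
    using convex_rel_interior_if2[OF assms(1,2)] hull_inc[OF assms(4)] by blast
  have "w \<bullet> z \<le> (1 - e) * (w \<bullet> a) + e * (w \<bullet> z)"
    using assms(3)[OF e(2)] by (simp add: inner_add_right)
  then have "(e - 1) * (w \<bullet> a - w \<bullet> z) \<le> 0"
    by (simp add: algebra_simps)
  then have "w \<bullet> a \<le> w \<bullet> z"
    using e(1) by (simp add: mult_le_0_iff)
  with assms(3)[OF assms(4)] show ?thesis by simp
qed

lemma normal_cone_sum_subset:
  "normal_cone x0 A + normal_cone x0 B \<subseteq> normal_cone x0 (A \<inter> B)"
  by (auto simp: normal_cone_def inner_add_left elim!: set_plus_elim) (meson add_nonpos_nonpos)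

text \<open>The separating normal is required to lie in the span of the separated set: only then does a
  vertical hyperplane contradict the relative interior condition, since with affine hulls of
  lower dimension some nonzero functional may vanish on the whole set.\<close>
lemma normal_cone_Int:
  fixes A B :: "'a::euclidean_space set"
  assumes A: "convex A" and B: "convex B"
    and ri: "rel_interior A \<inter> rel_interior B \<noteq> {}"
    and x0: "x0 \<in> A" "x0 \<in> B"
  shows "normal_cone x0 (A \<inter> B) = normal_cone x0 A + normal_cone x0 B"
proof
  show "normal_cone x0 (A \<inter> B) \<subseteq> normal_cone x0 A + normal_cone x0 B"
  proof
    fix v assume "v \<in> normal_cone x0 (A \<inter> B)"
    then have v: "\<And>x. x \<in> A \<Longrightarrow> x \<in> B \<Longrightarrow> v \<bullet> (x - x0) \<le> 0"
      by (auto simp: normal_cone_def)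
    define C where "C = {(a - b, r) | a b r. a \<in> A \<and> b \<in> B \<and> r < v \<bullet> (a - x0)}"
    have CI: "(a - b, r) \<in> C" if "a \<in> A" "b \<in> B" "r < v \<bullet> (a - x0)" for a b r
      using that unfolding C_def by blast
    have "convex C"
    proof (rule convexI)
      fix p q :: "'a \<times> real" and s t :: real
      assume "p \<in> C" "q \<in> C" and st: "0 \<le> s" "0 \<le> t" "s + t = 1"
      then obtain a b r a' b' r' where p: "p = (a - b, r)" "a \<in> A" "b \<in> B" "r < v \<bullet> (a - x0)"
        and q: "q = (a' - b', r')" "a' \<in> A" "b' \<in> B" "r' < v \<bullet> (a' - x0)"
        unfolding C_def by blast
      have "s * r + t * r' < s * (v \<bullet> (a - x0)) + t * (v \<bullet> (a' - x0))"
      proof (cases "s = 0")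
        case True
        then show ?thesis using st q(4) by simp
      next
        case False
        then show ?thesis
          using st p(4) q(4) by (intro add_less_le_mono mult_strict_left_mono mult_left_mono) auto
      qed
      also have "\<dots> = v \<bullet> ((s *\<^sub>R a + t *\<^sub>R a') - (s + t) *\<^sub>R x0)"
        by (simp add: inner_simps algebra_simps)
      finally have "s * r + t * r' < v \<bullet> ((s *\<^sub>R a + t *\<^sub>R a') - x0)"
        using st by simp
      with CI[of "s *\<^sub>R a + t *\<^sub>R a'" "s *\<^sub>R b + t *\<^sub>R b'" "s * r + t * r'"]
      show "s *\<^sub>R p + t *\<^sub>R q \<in> C"
        using convexD[OF A p(2) q(2) st] convexD[OF B p(3) q(3) st]
        by (simp add: p(1) q(1) algebra_simps)
    qed
    moreover have "(0, -1) \<in> C"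
      using CI[of x0 x0 "-1"] x0 by simp
    moreover have "0 \<notin> C"
      using v by (fastforce simp: C_def zero_prod_def)
    ultimately obtain n where n: "n \<in> span C" "n \<noteq> 0" "\<And>p. p \<in> C \<Longrightarrow> 0 \<le> n \<bullet> p"
      by (metis empty_iff separating_hyperplane_set_0_inspan)
    obtain w g where wg: "n = (w, g)" by (cases n)
    have sep: "0 \<le> w \<bullet> (a - b) + g * r" if "a \<in> A" "b \<in> B" "r < v \<bullet> (a - x0)" for a b r
      using n(3)[OF CI[OF that]] wg by simp
    have "g \<le> 0"
      using sep[OF x0, of "-1"] by simp
    moreover have "g \<noteq> 0"
    proof
      assume g: "g = 0"
      obtain z where z: "z \<in> rel_interior A" "z \<in> rel_interior B" using ri by blast
      have zA: "z \<in> A" and zB: "z \<in> B" using z rel_interior_subset by blast+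
      have le: "w \<bullet> b \<le> w \<bullet> a" if "a \<in> A" "b \<in> B" for a b
        using sep[OF that, of "v \<bullet> (a - x0) - 1"] g by (simp add: inner_diff_right)
      have "w \<bullet> a = w \<bullet> z" if "a \<in> A" for a
        using inner_constant_if_min_in_rel_interior[OF A z(1), of w a] le[OF _ zB] that by blast
      moreover have "w \<bullet> b = w \<bullet> z" if "b \<in> B" for b
        using inner_constant_if_min_in_rel_interior[OF B z(2), of "- w" b] le[OF zA] that by simp
      ultimately have "orthogonal n p" if "p \<in> C" for p
        using that g unfolding C_def wg by (auto simp: orthogonal_def inner_diff_right)
      then have "orthogonal n n"
        using n(1) orthogonal_to_span by blast
      with n(2) show False by (simp add: orthogonal_def)
    qed
    ultimately have g: "g < 0" by simp
    define u where "u = (1 / - g) *\<^sub>R w"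
    \<comment> \<open>The strict inequality defining \<open>C\<close> is lost by letting \<open>r\<close> tend to \<open>v \<bullet> (a - x0)\<close>.\<close>
    have main: "v \<bullet> (a - x0) \<le> u \<bullet> (a - b)" if "a \<in> A" "b \<in> B" for a b
    proof (rule dense_le)
      fix r assume "r < v \<bullet> (a - x0)"
      from sep[OF that this] have "- g * r \<le> w \<bullet> (a - b)" by simp
      then show "r \<le> u \<bullet> (a - b)" using g by (simp add: u_def field_simps)
    qed
    have "v - u \<in> normal_cone x0 A"
      using main[OF _ x0(2)] by (simp add: normal_cone_def inner_diff_left)
    moreover have "u \<in> normal_cone x0 B"
      using main[OF x0(1)] by (simp add: normal_cone_def inner_diff_right)
    ultimately have "(v - u) + u \<in> normal_cone x0 A + normal_cone x0 B"
      by (rule set_plus_intro)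
    then show "v \<in> normal_cone x0 A + normal_cone x0 B" by simp
  qed
qed (rule normal_cone_sum_subset)

lemma rel_interior_finite_INT:
  fixes \<Omega> :: "'i \<Rightarrow> 'a::euclidean_space set"
  assumes "finite I" "\<And>i. i \<in> I \<Longrightarrow> convex (\<Omega> i)" "(\<Inter>i\<in>I. rel_interior (\<Omega> i)) \<noteq> {}"
  shows "rel_interior (\<Inter>i\<in>I. \<Omega> i) = (\<Inter>i\<in>I. rel_interior (\<Omega> i))"
  using convex_rel_interior_finite_Inter[of "\<Omega> ` I"] assms by (auto simp: image_image)

text \<open>The empty family anchors the induction: its intersection is the whole space, whose normal cone
  is \<open>{0}\<close>, the neutral element of the Minkowski sum.\<close>
lemma normal_cone_finite_INT:
  fixes \<Omega> :: "'i \<Rightarrow> 'a::euclidean_space set"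
  assumes "finite I" "\<And>i. i \<in> I \<Longrightarrow> convex (\<Omega> i)" "(\<Inter>i\<in>I. rel_interior (\<Omega> i)) \<noteq> {}"
    and "\<And>i. i \<in> I \<Longrightarrow> x0 \<in> \<Omega> i"
  shows "normal_cone x0 (\<Inter>i\<in>I. \<Omega> i) = (\<Sum>i\<in>I. normal_cone x0 (\<Omega> i))"
  using assms
proof (induction I rule: finite_induct)
  case empty
  then show ?case by (simp add: normal_cone_UNIV set_zero)
next
  case (insert j I)
  have ne: "(\<Inter>i\<in>I. rel_interior (\<Omega> i)) \<noteq> {}" using insert.prems(2) by auto
  have "rel_interior (\<Omega> j) \<inter> rel_interior (\<Inter>i\<in>I. \<Omega> i) \<noteq> {}"
    using rel_interior_finite_INT[of I \<Omega>] insert.hyps insert.prems ne by simp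
  then have "normal_cone x0 (\<Omega> j \<inter> (\<Inter>i\<in>I. \<Omega> i))
      = normal_cone x0 (\<Omega> j) + normal_cone x0 (\<Inter>i\<in>I. \<Omega> i)"
    using insert.prems by (intro normal_cone_Int convex_INT) auto
  then show ?case using insert ne by simp
qed

theorem theorem5p3:
  fixes m :: nat and \<Omega> :: "nat \<Rightarrow> (real ^ 'n) set"
  assumes "m \<ge> 2"
    and "\<And>i. i \<in> {1..m} \<Longrightarrow> convex (\<Omega> i)"
    and "(\<Inter>i\<in>{1..m}. rel_interior (\<Omega> i)) \<noteq> {}"
  shows "\<forall>x0 \<in> (\<Inter>i\<in>{1..m}. \<Omega> i).
           normal_cone x0 (\<Inter>i\<in>{1..m}. \<Omega> i) = (\<Sum>i\<in>{1..m}. normal_cone x0 (\<Omega> i))"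
  using assms(2,3) by (intro ballI normal_cone_finite_INT) auto

end
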